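(* $\tilde{\mathbb X}\equiv\mathbb X\subseteq\mathbb X_{nc}\subseteq\mathbb X^+$. If $\tilde G$ is a tree then $\tilde{\mathbb X}\equiv\mathbb X=\mathbb X_{nc}\subseteq\mathbb X^+$. Here $A\equiv B$ means that there is a bijection between the sets $A$ and $B$.
   Context: Let $N^+=\{0,\dots,n\}$, $N=\{1,\dots,n\}$ and let $\tilde G=(N^+,\tilde E)$ be a connected directed graph with $m=|\tilde E|$ edges, obtained by arbitrarily orienting a connected undirected simple graph ($\tilde G$ is a tree if the undirected graph is). Each line $j\to k\in\tilde E$ has nonzero complex impedance $z_{jk}$ and admittance $y_{jk}=1/z_{jk}$. For complex numbers, $a\le b$ means inequality of both real and imaginary parts. Given are bounds $\underline v_j\le\overline v_j$ with $\underline v_j>0$ and complex bounds $\underline s_j,\overline s_j$ (possibly infinite), $j\in N^+$; for the slack bus $V_0=1$, $\underline v_0=\overline v_0=1$, and the bounds on $s_0$ are infinite (no constraint). $\tilde{\mathbb X}$ is the set of $\tilde x=(S,I,V,s)\in\mathbb C^{2(m+n+1)}$ with $V_0=1$ such that - $\sum_{k:j\to k}S_{jk}=\sum_{i:i\to j}(S_{ij}-z_{ij}|I_{ij}|^2)+s_j$, $j\in N^+$; - $I_{jk}=y_{jk}(V_j-V_k)$ and $S_{jk}=V_jI_{jk}^H$, $j\to k\in\tilde E$; - $\underline v_j\le|V_j|^2\le\overline v_j$ and $\underline s_j\le s_j\le\overline s_j$, $j\in N^+$. For $x=(S,\ell,v,s)\in\mathbb R^{3(m+n+1)}$ ($S\in\mathbb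 C^m$ and $s\in\mathbb C^{n+1}$ regarded as real vectors, $\ell\in\mathbb R^m$, $v\in\mathbb R^{n+1}$) consider (a) $\sum_{k:j\to k}S_{jk}=\sum_{i:i\to j}(S_{ij}-z_{ij}\ell_{ij})+s_j$, $j\in N^+$; (b) $v_j-v_k=2\operatorname{Re}(z_{jk}^HS_{jk})-|z_{jk}|^2\ell_{jk}$, $j\to k\in\tilde E$; (c) $v_j\ell_{jk}=|S_{jk}|^2$, $j\to k\in\tilde E$; (c') $v_j\ell_{jk}\ge|S_{jk}|^2$, $j\to k\in\tilde E$; (d) $\underline v_j\le v_j\le\overline v_j$ and $\underline s_j\le s_j\le\overline s_j$, $j\in N^+$; (e) there exists $\theta\in\mathbb R^n$ with $B\theta=\beta(x)\mod 2\pi$ (componentwise), where $\beta_{jk}(x)=\angle(v_j-z_{jk}^HS_{jk})$ for $j\to k\in\tilde E$, and $B$ is the $m\times n$ reduced incidence matrix: for $l\in\tilde E$, $j\in N$, $B_{lj}=1$ if $l$ leaves $j$, $-1$ if $l$ enters $j$, $0$ otherwise. $\mathbb X_{nc}$ is the set of $x$ satisfying (a),(b),(c),(d); $\mathbb X$ the set of $x$ satisfying (a),(b),(c),(d),(e); $\mathbb X^+$ the set of $x$ satisfying (a),(b),(c'),(d). *)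

theory Defs
  imports
    "HOL-Analysis.Analysis"
    "HOL-Library.Equipollence"
    "HOL-Library.Real_Mod"
    "Graph_Theory.Graph_Theory"
begin

text \<open>
  Buses are the natural numbers 0, ..., \<open>n\<close>, bus 0 being the slack bus; a line from
  \<open>j\<close> to \<open>k\<close> is the pair \<open>(j, k)\<close>.  Vectors indexed by a finite set \<open>A\<close> (of buses or of lines)
  are functions in \<open>extensional A\<close>, so that equality of vectors is equality of their components
  on \<open>A\<close>.
\<close>

subsection \<open>Network graph\<close>

definition network_graph :: "nat \<Rightarrow> (nat \<times> nat) set \<Rightarrow> nat pair_pre_digraph" where
  "network_graph n E = \<lparr> pverts = {0..n}, parcs = E \<rparr>"

text \<open>
  \<open>asym E\<close> expresses that \<open>E\<close> arises by orienting the edges of a simple graph: it excludes loops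
  as well as pairs of antiparallel lines.  Connectedness in \<open>Graph_Theory\<close> refers to the
  underlying undirected graph.
\<close>

definition connected_network :: "nat \<Rightarrow> (nat \<times> nat) set \<Rightarrow> bool" where
  "connected_network n E \<longleftrightarrow>
     E \<subseteq> {0..n} \<times> {0..n} \<and> asym E \<and>
     Digraph_Component.connected (with_proj (network_graph n E))"

text \<open>
  The constant \<open>tree\<close> of \<open>Graph_Theory\<close> only excludes directed cycles, whereas here the underlying
  undirected graph has to be acyclic.  In its symmetric digraph, every edge traversed back and
  forth is a cycle of length 2; the cycles of the undirected graph are those of length at least 3.
\<close>

definition tree_network :: "nat \<Rightarrow> (nat \<times> nat) set \<Rightarrow> bool" where
  "tree_network n E \<longleftrightarrow>
     connected_network n E \<and>
     \<not> (\<exists>p. pre_digraph.cycle (with_proj (mk_symmetric (with_proj (network_graph n E)))) p \<and>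
            3 \<le> length p)"

text \<open>The row index is a line, the column index a bus other than 0.\<close>

definition reduced_incidence :: "nat \<times> nat \<Rightarrow> nat \<Rightarrow> real" where
  "reduced_incidence l j = (if fst l = j then 1 else if snd l = j then - 1 else 0)"

subsection \<open>Constraints\<close>

text \<open>
  Bounds on complex quantities are pairs of extended reals (bound on the real part, bound on the
  imaginary part).
\<close>

definition complex_between :: "ereal \<times> ereal \<Rightarrow> complex \<Rightarrow> ereal \<times> ereal \<Rightarrow> bool" where
  "complex_between a c b \<longleftrightarrow>
     fst a \<le> ereal (Re c) \<and> ereal (Re c) \<le> fst b \<and>
     snd a \<le> ereal (Im c) \<and> ereal (Im c) \<le> snd b"

definition within_limits ::
  "nat \<Rightarrow> (nat \<Rightarrow> real) \<Rightarrow> (nat \<Rightarrow> real) \<Rightarrow> (nat \<Rightarrow> ereal \<times> ereal) \<Rightarrow> (nat \<Rightarrow> ereal \<times> ereal) \<Rightarrow>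
   (nat \<Rightarrow> real) \<Rightarrow> (nat \<Rightarrow> complex) \<Rightarrow> bool" where
  "within_limits n vmin vmax smin smax v s \<longleftrightarrow>
     (\<forall>j\<in>{0..n}. vmin j \<le> v j \<and> v j \<le> vmax j \<and> complex_between (smin j) (s j) (smax j))"

definition power_balance ::
  "nat \<Rightarrow> (nat \<times> nat) set \<Rightarrow> (nat \<times> nat \<Rightarrow> complex) \<Rightarrow>
   (nat \<times> nat \<Rightarrow> complex) \<Rightarrow> (nat \<times> nat \<Rightarrow> real) \<Rightarrow> (nat \<Rightarrow> complex) \<Rightarrow> bool" where
  "power_balance n E z S L s \<longleftrightarrow>
     (\<forall>j\<in>{0..n}.
        (\<Sum>k | (j, k) \<in> E. S (j, k)) =
        (\<Sum>i | (i, j) \<in> E. S (i, j) - z (i, j) * complex_of_real (L (i, j))) + s j)"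

definition admittance :: "(nat \<times> nat \<Rightarrow> complex) \<Rightarrow> nat \<times> nat \<Rightarrow> complex" where
  "admittance z l = 1 / z l"

definition voltage_drop ::
  "(nat \<times> nat) set \<Rightarrow> (nat \<times> nat \<Rightarrow> complex) \<Rightarrow>
   (nat \<times> nat \<Rightarrow> complex) \<Rightarrow> (nat \<times> nat \<Rightarrow> real) \<Rightarrow> (nat \<Rightarrow> real) \<Rightarrow> bool" where
  "voltage_drop E z S L v \<longleftrightarrow>
     (\<forall>(j, k)\<in>E. v j - v k = 2 * Re (cnj (z (j, k)) * S (j, k)) - (cmod (z (j, k)))\<^sup>2 * L (j, k))"

definition branch_angle ::
  "(nat \<times> nat \<Rightarrow> complex) \<Rightarrow> (nat \<times> nat \<Rightarrow> complex) \<Rightarrow> (nat \<Rightarrow> real) \<Rightarrow> nat \<times> nat \<Rightarrow> real" where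
  "branch_angle z S v l = Arg (complex_of_real (v (fst l)) - cnj (z l) * S l)"

definition cycle_condition ::
  "nat \<Rightarrow> (nat \<times> nat) set \<Rightarrow> (nat \<times> nat \<Rightarrow> complex) \<Rightarrow>
   (nat \<times> nat \<Rightarrow> complex) \<Rightarrow> (nat \<Rightarrow> real) \<Rightarrow> bool" where
  "cycle_condition n E z S v \<longleftrightarrow>
     (\<exists>\<theta> :: nat \<Rightarrow> real. \<forall>l\<in>E.
        [(\<Sum>j\<in>{1..n}. reduced_incidence l j * \<theta> j) = branch_angle z S v l] (rmod (2 * pi)))"

subsection \<open>Feasible sets\<close>

type_synonym complex_flow_point =
  "(nat \<times> nat \<Rightarrow> complex) \<times> (nat \<times> nat \<Rightarrow> complex) \<times> (nat \<Rightarrow> complex) \<times> (nat \<Rightarrow> complex)"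

type_synonym branch_flow_point =
  "(nat \<times> nat \<Rightarrow> complex) \<times> (nat \<times> nat \<Rightarrow> real) \<times> (nat \<Rightarrow> real) \<times> (nat \<Rightarrow> complex)"

definition X_tilde ::
  "nat \<Rightarrow> (nat \<times> nat) set \<Rightarrow> (nat \<times> nat \<Rightarrow> complex) \<Rightarrow> (nat \<Rightarrow> real) \<Rightarrow> (nat \<Rightarrow> real) \<Rightarrow>
   (nat \<Rightarrow> ereal \<times> ereal) \<Rightarrow> (nat \<Rightarrow> ereal \<times> ereal) \<Rightarrow> complex_flow_point set" where
  "X_tilde n E z vmin vmax smin smax =
     {(S, I, V, s).
        S \<in> extensional E \<and> I \<in> extensional E \<and>
        V \<in> extensional {0..n} \<and> s \<in> extensional {0..n} \<and>
        V 0 = 1 \<and>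
        power_balance n E z S (\<lambda>l. (cmod (I l))\<^sup>2) s \<and>
        (\<forall>(j, k)\<in>E. I (j, k) = admittance z (j, k) * (V j - V k) \<and> S (j, k) = V j * cnj (I (j, k))) \<and>
        within_limits n vmin vmax smin smax (\<lambda>j. (cmod (V j))\<^sup>2) s}"

definition X_nc ::
  "nat \<Rightarrow> (nat \<times> nat) set \<Rightarrow> (nat \<times> nat \<Rightarrow> complex) \<Rightarrow> (nat \<Rightarrow> real) \<Rightarrow> (nat \<Rightarrow> real) \<Rightarrow>
   (nat \<Rightarrow> ereal \<times> ereal) \<Rightarrow> (nat \<Rightarrow> ereal \<times> ereal) \<Rightarrow> branch_flow_point set" where
  "X_nc n E z vmin vmax smin smax =
     {(S, L, v, s).
        S \<in> extensional E \<and> L \<in> extensional E \<and>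
        v \<in> extensional {0..n} \<and> s \<in> extensional {0..n} \<and>
        power_balance n E z S L s \<and>
        voltage_drop E z S L v \<and>
        (\<forall>(j, k)\<in>E. v j * L (j, k) = (cmod (S (j, k)))\<^sup>2) \<and>
        within_limits n vmin vmax smin smax v s}"

definition X_cyc ::
  "nat \<Rightarrow> (nat \<times> nat) set \<Rightarrow> (nat \<times> nat \<Rightarrow> complex) \<Rightarrow> (nat \<Rightarrow> real) \<Rightarrow> (nat \<Rightarrow> real) \<Rightarrow>
   (nat \<Rightarrow> ereal \<times> ereal) \<Rightarrow> (nat \<Rightarrow> ereal \<times> ereal) \<Rightarrow> branch_flow_point set" where
  "X_cyc n E z vmin vmax smin smax =
     {(S, L, v, s).
        S \<in> extensional E \<and> L \<in> extensional E \<and>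
        v \<in> extensional {0..n} \<and> s \<in> extensional {0..n} \<and>
        power_balance n E z S L s \<and>
        voltage_drop E z S L v \<and>
        (\<forall>(j, k)\<in>E. v j * L (j, k) = (cmod (S (j, k)))\<^sup>2) \<and>
        within_limits n vmin vmax smin smax v s \<and>
        cycle_condition n E z S v}"

definition X_plus ::
  "nat \<Rightarrow> (nat \<times> nat) set \<Rightarrow> (nat \<times> nat \<Rightarrow> complex) \<Rightarrow> (nat \<Rightarrow> real) \<Rightarrow> (nat \<Rightarrow> real) \<Rightarrow>
   (nat \<Rightarrow> ereal \<times> ereal) \<Rightarrow> (nat \<Rightarrow> ereal \<times> ereal) \<Rightarrow> branch_flow_point set" where
  "X_plus n E z vmin vmax smin smax =
     {(S, L, v, s).
        S \<in> extensional E \<and> L \<in> extensional E \<and>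
        v \<in> extensional {0..n} \<and> s \<in> extensional {0..n} \<and>
        power_balance n E z S L s \<and>
        voltage_drop E z S L v \<and>
        (\<forall>(j, k)\<in>E. v j * L (j, k) \<ge> (cmod (S (j, k)))\<^sup>2) \<and>
        within_limits n vmin vmax smin smax v s}"

end

theory Submission
  imports Defs
begin

text \<open>
  On a line from \<open>j\<close> to \<open>k\<close>, Ohm's law turns \<open>v\<^sub>j - z\<^sup>H S\<close> into \<open>V\<^sub>j V\<^sub>k\<^sup>H\<close>.  Since \<open>V\<^sub>0 = 1\<close> and
  the network is connected, these products determine \<open>V\<close>, so that
  \<open>(S, I, V, s) \<mapsto> (S, \<bar>I\<bar>\<^sup>2, \<bar>V\<bar>\<^sup>2, s)\<close> is injective.  Conversely, the branch flow equations force
  \<open>\<bar>v\<^sub>j - z\<^sup>H S\<bar>\<^sup>2 = v\<^sub>j v\<^sub>k\<close>, hence a solution \<open>\<theta>\<close> of the cycle condition yields the voltages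
  \<open>V\<^sub>j = \<surd>v\<^sub>j e\<^sup>i\<^sup>\<theta>\<^sup>j\<close>.  In a tree every prescribed family of branch angles is a difference of
  potentials: when a line is added to a forest, the potential of the component at one of its ends
  can be shifted freely.
\<close>

section \<open>Potentials on forests\<close>

lemma potential_insert:
  fixes \<theta> :: "'a \<Rightarrow> real"
  assumes pot: "\<forall>(j, k)\<in>F. \<theta> j - \<theta> k = \<beta> (j, k)"
    and sep: "(a, b) \<notin> (F \<union> F\<inverse>)\<^sup>*"
  shows "\<exists>\<theta>'::'a \<Rightarrow> real. \<forall>(j, k)\<in>insert (a, b) F. \<theta>' j - \<theta>' k = \<beta> (j, k)"
proof -
  \<comment> \<open>\<open>c\<close> is the defect of \<theta> on the new line. Raising the whole
    component of \<open>a\<close> by \<open>c\<close> repairs it, because \<open>b\<close> lies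
    outside that component, and no line of \<open>F\<close> joins the component to the rest.\<close>
  define c where "c = \<beta> (a, b) - (\<theta> a - \<theta> b)"
  define \<theta>' where "\<theta>' j = (if (a, j) \<in> (F \<union> F\<inverse>)\<^sup>* then \<theta> j + c else \<theta> j)" for j
  have "(a, j) \<in> (F \<union> F\<inverse>)\<^sup>* \<longleftrightarrow> (a, k) \<in> (F \<union> F\<inverse>)\<^sup>*" if "(j, k) \<in> F" for j k
    using that by (meson UnCI converseI rtrancl.rtrancl_into_rtrancl)
  with pot have "\<theta>' j - \<theta>' k = \<beta> (j, k)" if "(j, k) \<in> F" for j k
    using that by (force simp: \<theta>'_def)
  moreover have "\<theta>' a - \<theta>' b = \<beta> (a, b)"
    using sep by (simp add: \<theta>'_def c_def)
  ultimately show ?thesis by blast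
qed

text \<open>A simple path from \<open>a\<close> to \<open>b\<close> through \<open>F\<close> is
  closed by the arc \<open>(b, a)\<close>. The path has at least two arcs, because \<open>a\<close>
  and \<open>b\<close> differ and no line of \<open>F\<close> joins them directly. The cycle is
  therefore not a mere back-and-forth traversal of one edge.\<close>

lemma undirected_cycle:
  fixes V :: "'a set"
  assumes F: "F \<subseteq> V \<times> V" and ab: "a \<in> V" "a \<noteq> b" "(a, b) \<notin> F" "(b, a) \<notin> F"
    and conn: "(a, b) \<in> (F \<union> F\<inverse>)\<^sup>*"
    and E: "insert (a, b) F \<subseteq> E" "E \<subseteq> V \<times> V"
  shows "\<exists>p. pre_digraph.cycle (with_proj \<lparr>pverts = V, parcs = E \<union> E\<inverse>\<rparr>) p \<and> 3 \<le> length p"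
proof -
  define H where "H = \<lparr>pverts = V, parcs = F \<union> F\<inverse>\<rparr>"
  interpret H: pair_wf_digraph H
    using F by unfold_locales (auto simp: H_def)
  have "(a, b) \<in> rtrancl_on V (F \<union> F\<inverse>)"
    using conn by (induct) (use F ab(1) in \<open>auto intro: rtrancl_on_into_rtrancl_on\<close>)
  then have "a \<rightarrow>\<^sup>*\<^bsub>with_proj H\<^esub> b"
    by (simp add: reachable_def H_def)
  then obtain p where p: "H.apath a p b"
    using H.reachable_apath by blast
  then have aw: "set p \<subseteq> F \<union> F\<inverse>" "pcas a p b" "distinct (pawalk_verts a p)"
    unfolding H.apath_def H.awalk_def by (simp_all add: H_def)
  have "2 \<le> length p"
  proof (rule ccontr)
    assume "\<not> 2 \<le> length p"
    then consider "p = []" | e where "p = [e]"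
      by (cases p; cases "tl p") auto
    then show False
      using aw ab by cases (auto simp: prod_eq_iff)
  qed
  \<comment> \<open>Starting the closed walk at \<open>b\<close>, the vertices after the first are
    exactly those of the simple path \<open>p\<close>, so their distinctness is already
    known.\<close>
  moreover have "pre_digraph.cycle (with_proj \<lparr>pverts = V, parcs = E \<union> E\<inverse>\<rparr>) ((b, a) # p)"
    unfolding pre_digraph.cycle_def pre_digraph.awalk_def cas_with_proj_eq
      awalk_verts_with_proj_eq
    using aw E by (intro exI[of _ b]) auto
  ultimately show ?thesis
    by (intro exI[of _ "(b, a) # p"]) auto
qed

lemma forest_potential:
  fixes \<beta> :: "'a \<times> 'a \<Rightarrow> real"
  assumes "finite E" "E \<subseteq> V \<times> V" "asym E"
    and acyclic: "\<not> (\<exists>p. pre_digraph.cycle (with_proj \<lparr>pverts = V, parcs = E \<union> E\<inverse>\<rparr>) p \<and> 3 \<le> length p)"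
  shows "\<exists>\<theta>::'a \<Rightarrow> real. \<forall>(j, k)\<in>E. \<theta> j - \<theta> k = \<beta> (j, k)"
proof -
  \<comment> \<open>The induction adds lines to subsets \<open>F\<close> of the fixed
    \<open>E\<close>, so that acyclicity of \<open>E\<close> remains available. A new line with
    already connected ends would close a cycle.\<close>
  have "\<exists>\<theta>::'a \<Rightarrow> real. \<forall>(j, k)\<in>F. \<theta> j - \<theta> k = \<beta> (j, k)" if "F \<subseteq> E" for F
    using finite_subset[OF that assms(1)] that
  proof (induct F)
    case empty
    show ?case by simp
  next
    case (insert l F)
    obtain a b where l: "l = (a, b)" by fastforce
    have E: "(a, b) \<in> E" "F \<subseteq> E" "(b, a) \<notin> E"
      using insert.prems l \<open>asym E\<close> by (auto dest: asymD)
    have "(a, b) \<notin> (F \<union> F\<inverse>)\<^sup>*"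
      using undirected_cycle[of F V a b E] acyclic assms(2) E insert.hyps(2) l by blast
    moreover obtain \<theta> :: "'a \<Rightarrow> real" where "\<forall>(j, k)\<in>F. \<theta> j - \<theta> k = \<beta> (j, k)"
      using insert by blast
    ultimately show ?case
      unfolding l by (intro potential_insert)
  qed
  then show ?thesis by blast
qed

section \<open>Connectedness and the cycle condition\<close>

lemma mk_symmetric_network_graph:
  "mk_symmetric (with_proj (network_graph n E)) = \<lparr>pverts = {0..n}, parcs = E \<union> E\<inverse>\<rparr>"
  by (force simp: mk_symmetric_def network_graph_def)

lemma connected_network_lines:
  assumes "connected_network n E" "(j, k) \<in> E"
  shows "j \<in> {0..n}" "k \<in> {0..n}" "j \<noteq> k"
  using assms by (auto simp: connected_network_def dest: asymD)

text \<open>Propagation from the slack bus along undirected paths. The premise on lines is an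
  equivalence because such a path may traverse a line against its orientation.\<close>

lemma connected_network_induct:
  assumes "connected_network n E" "j \<in> {0..n}" "P 0"
    and "\<And>j k. (j, k) \<in> E \<Longrightarrow> P j \<longleftrightarrow> P k"
  shows "P j"
proof -
  have "(0, j) \<in> rtrancl_on {0..n} (E \<union> E\<inverse>)"
    using assms(1,2)
    by (auto simp: connected_network_def connected_def strongly_connected_def reachable_def
        mk_symmetric_network_graph)
  then show ?thesis
    by (induct rule: rtrancl_on_induct) (use assms(3,4) in auto)
qed

text \<open>Omitting the column of bus 0 amounts to fixing the reference angle there at 0, whence
  \<open>\<theta>(0 := 0)\<close>.\<close>

lemma sum_reduced_incidence:
  assumes "j \<in> {0..n}" "k \<in> {0..n}" "j \<noteq> k"
  shows "(\<Sum>i\<in>{1..n}. reduced_incidence (j, k) i * \<theta> i) = (\<theta>(0 := 0)) j - (\<theta>(0 := 0)) k"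
proof -
  have "(\<Sum>i\<in>{1..n}. reduced_incidence (j, k) i * \<theta> i) =
      (\<Sum>i\<in>{1..n}. (if j = i then \<theta> i else 0) - (if k = i then \<theta> i else 0))"
    using assms by (intro sum.cong) (auto simp: reduced_incidence_def)
  also have "\<dots> = (\<theta>(0 := 0)) j - (\<theta>(0 := 0)) k"
    using assms by (auto simp: sum_subtractf)
  finally show ?thesis .
qed

lemma cycle_condition_iff:
  assumes "connected_network n E"
  shows "cycle_condition n E z S v \<longleftrightarrow>
    (\<exists>\<theta>. \<theta> 0 = 0 \<and> (\<forall>(j, k)\<in>E. [\<theta> j - \<theta> k = branch_angle z S v (j, k)] (rmod (2 * pi))))"
    (is "_ \<longleftrightarrow> ?R")
proof -
  have *: "(\<forall>l\<in>E. [(\<Sum>j\<in>{1..n}. reduced_incidence l j * \<theta> j) = branch_angle z S v l] (rmod (2 * pi)))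
      \<longleftrightarrow> (\<forall>(j, k)\<in>E. [(\<theta>(0 := 0)) j - (\<theta>(0 := 0)) k = branch_angle z S v (j, k)] (rmod (2 * pi)))" for \<theta>
    using sum_reduced_incidence[OF connected_network_lines[OF assms], where \<theta> = \<theta>]
    by (intro ball_cong) (auto split: prod.splits)
  show ?thesis
  proof
    assume "cycle_condition n E z S v"
    then obtain \<theta> where "\<forall>(j, k)\<in>E. [(\<theta>(0 := 0)) j - (\<theta>(0 := 0)) k = branch_angle z S v (j, k)] (rmod (2 * pi))"
      unfolding cycle_condition_def * by blast
    then show ?R
      by (intro exI[of _ "\<theta>(0 := 0)"] conjI) simp_all
  next
    assume ?R
    then obtain \<theta> where "\<theta> 0 = 0"
        "\<forall>(j, k)\<in>E. [\<theta> j - \<theta> k = branch_angle z S v (j, k)] (rmod (2 * pi))"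
      by blast
    moreover from this have "\<theta>(0 := 0) = \<theta>"
      by (simp add: fun_upd_idem)
    ultimately show "cycle_condition n E z S v"
      unfolding cycle_condition_def * by (intro exI[of _ \<theta>]) simp
  qed
qed

lemma cycle_condition_tree:
  assumes "tree_network n E"
  shows "cycle_condition n E z S v"
proof -
  have conn: "connected_network n E"
    using assms by (simp add: tree_network_def)
  then have "E \<subseteq> {0..n} \<times> {0..n}" "asym E"
    by (auto simp: connected_network_def)
  moreover from this have "finite E"
    by (meson finite_SigmaI finite_atLeastAtMost finite_subset)
  ultimately obtain \<theta> :: "nat \<Rightarrow> real"
    where "\<forall>(j, k)\<in>E. \<theta> j - \<theta> k = branch_angle z S v (j, k)"
    using forest_potential[of E "{0..n}" "branch_angle z S v"] assms
    unfolding tree_network_def mk_symmetric_network_graph by blast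
  then show ?thesis
    unfolding cycle_condition_iff[OF conn]
    \<comment> \<open>Subtracting \<open>\<theta> 0\<close> makes the potential vanish at the slack
      bus and leaves all differences unchanged.\<close>
    by (intro exI[of _ "\<lambda>j. \<theta> j - \<theta> 0"]) (auto split: prod.splits)
qed

section \<open>Identities on a single line\<close>

lemma ohm_voltage_product:
  assumes "z \<noteq> 0" "i = (a - b) / z" "S = a * cnj i"
  shows "of_real ((cmod a)\<^sup>2) - cnj z * S = a * cnj b"
proof -
  have "cnj z * S = a * cnj (z * i)"
    using assms(3) by simp
  also have "z * i = a - b"
    using assms(1,2) by simp
  finally show ?thesis
    unfolding complex_norm_square by (simp add: algebra_simps)
qed

lemma cmod_diff_squared:
  "(cmod (a - u))\<^sup>2 = (cmod a)\<^sup>2 - 2 * Re (a * cnj u) + (cmod u)\<^sup>2"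
  by (simp add: cmod_power2 power2_diff algebra_simps)

text \<open>This is the law of cosines for \<open>b = a - z * i\<close>. The cross term is
  \<open>cnj z * S\<close> because \<open>S = a * cnj i\<close>.\<close>

lemma ohm_voltage_drop:
  assumes "z \<noteq> 0" "i = (a - b) / z" "S = a * cnj i"
  shows "(cmod a)\<^sup>2 - (cmod b)\<^sup>2 = 2 * Re (cnj z * S) - (cmod z)\<^sup>2 * (cmod i)\<^sup>2"
proof -
  have b: "b = a - z * i"
    using assms by simp
  have "cnj z * S = a * cnj (z * i)"
    using assms(3) by simp
  then show ?thesis
    \<comment> \<open>\<open>cnj (z * i)\<close> has to stay unexpanded to match the cross term of
      the expansion.\<close>
    by (simp add: b cmod_diff_squared norm_mult power_mult_distrib del: complex_cnj_mult)
qed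

text \<open>Congruence modulo \<open>2 * pi\<close> is equality under \<open>cis\<close>. There the
  claim holds because the inverse of the unit number \<open>sgn b\<close> is its conjugate.\<close>

lemma rcong_Arg_mult_cnj:
  assumes "a \<noteq> 0" "b \<noteq> 0"
  shows "[Arg a - Arg b = Arg (a * cnj b)] (rmod (2 * pi))"
proof -
  have "cis (Arg a - Arg b) = sgn a / sgn b"
    using assms by (simp add: cis_divide [symmetric] cis_Arg)
  also have "\<dots> = sgn (a * cnj b)"
    using assms by (simp add: sgn_eq field_simps norm_mult complex_norm_square [symmetric] power2_eq_square)
  also have "\<dots> = cis (Arg (a * cnj b))"
    using assms by (simp add: cis_Arg)
  finally show ?thesis
    by (simp add: cis_eq_iff)
qed

section \<open>The map forgetting phases\<close>

lemma power_balance_cong: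
  assumes "\<And>l. l \<in> E \<Longrightarrow> L l = L' l"
  shows "power_balance n E z S L s \<longleftrightarrow> power_balance n E z S L' s"
proof -
  have "(\<Sum>i | (i, j) \<in> E. S (i, j) - z (i, j) * complex_of_real (L (i, j))) =
      (\<Sum>i | (i, j) \<in> E. S (i, j) - z (i, j) * complex_of_real (L' (i, j)))" for j
    using assms by (intro sum.cong) auto
  then show ?thesis by (simp add: power_balance_def)
qed

lemma within_limits_cong:
  assumes "\<And>j. j \<in> {0..n} \<Longrightarrow> v j = v' j"
  shows "within_limits n vmin vmax smin smax v s \<longleftrightarrow> within_limits n vmin vmax smin smax v' s"
  using assms by (auto simp: within_limits_def)

text \<open>\<open>restrict\<close> keeps the squared moduli in the extensional function spaces, as
  membership in \<open>X_cyc\<close> demands.\<close>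

definition flow_of_voltages ::
  "nat \<Rightarrow> (nat \<times> nat) set \<Rightarrow> complex_flow_point \<Rightarrow> branch_flow_point" where
  "flow_of_voltages n E = (\<lambda>(S, I, V, s).
     (S, restrict (\<lambda>l. (cmod (I l))\<^sup>2) E, restrict (\<lambda>j. (cmod (V j))\<^sup>2) {0..n}, s))"

section \<open>The bijection between \<open>X_tilde\<close> and \<open>X_cyc\<close>\<close>

locale network =
  fixes n :: nat
    and E :: "(nat \<times> nat) set"
    and z :: "nat \<times> nat \<Rightarrow> complex"
    and vmin vmax :: "nat \<Rightarrow> real"
    and smin smax :: "nat \<Rightarrow> ereal \<times> ereal"
  assumes conn: "connected_network n E"
    and z_nonzero: "\<And>l. l \<in> E \<Longrightarrow> z l \<noteq> 0"
    and vmin_pos: "\<And>j. j \<in> {0..n} \<Longrightarrow> 0 < vmin j"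
    and slack: "vmin 0 = 1" "vmax 0 = 1"
begin

abbreviation "Xt \<equiv> X_tilde n E z vmin vmax smin smax"
abbreviation "Xc \<equiv> X_cyc n E z vmin vmax smin smax"

lemmas line_ends = connected_network_lines[OF conn]

lemma within_limits_pos:
  assumes "within_limits n vmin vmax smin smax v s" "j \<in> {0..n}"
  shows "0 < v j"
  using assms vmin_pos[of j] unfolding within_limits_def by (meson less_le_trans)

lemma X_tilde_line:
  assumes "(S, I, V, s) \<in> Xt" "(j, k) \<in> E"
  shows "I (j, k) = (V j - V k) / z (j, k)" "S (j, k) = V j * cnj (I (j, k))" "V j \<noteq> 0" "V k \<noteq> 0"
proof -
  show "I (j, k) = (V j - V k) / z (j, k)" "S (j, k) = V j * cnj (I (j, k))"
    using assms by (auto simp: X_tilde_def admittance_def)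
  have "0 < (cmod (V i))\<^sup>2" if "i \<in> {0..n}" for i
    using assms(1) within_limits_pos[of "\<lambda>j. (cmod (V j))\<^sup>2" s i] that
    by (auto simp: X_tilde_def)
  then show "V j \<noteq> 0" "V k \<noteq> 0"
    using line_ends[OF assms(2)] by auto
qed

lemma X_tilde_product:
  assumes "(S, I, V, s) \<in> Xt" "(j, k) \<in> E"
  shows "of_real ((cmod (V j))\<^sup>2) - cnj (z (j, k)) * S (j, k) = V j * cnj (V k)"
  using ohm_voltage_product[OF z_nonzero[OF assms(2)] X_tilde_line(1,2)[OF assms]] .

lemma inj_on_flow: "inj_on (flow_of_voltages n E) Xt"
proof (rule inj_onI)
  fix x x' assume x: "x \<in> Xt" and x': "x' \<in> Xt" and eq: "flow_of_voltages n E x = flow_of_voltages n E x'"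
  obtain S I V s I' V' where xs: "x = (S, I, V, s)" "x' = (S, I', V', s)"
    using eq by (cases x; cases x') (auto simp: flow_of_voltages_def)
  note x = x[unfolded xs(1)] and x' = x'[unfolded xs(2)]
  have norms: "(cmod (V j))\<^sup>2 = (cmod (V' j))\<^sup>2" if "j \<in> {0..n}" for j
    using eq that unfolding xs flow_of_voltages_def by (auto dest!: fun_cong[where x = j])
  have "V j = V' j" if "j \<in> {0..n}" for j
    using conn that
  proof (rule connected_network_induct)
    show "V 0 = V' 0"
      using x x' by (simp add: X_tilde_def)
  next
    fix j k assume jk: "(j, k) \<in> E"
    \<comment> \<open>The product depends only on \<open>S\<close> and the squared modulus at
      \<open>j\<close>, which both points share. As all voltages are nonzero, agreement at one end
      then forces agreement at the other.\<close>
    have "V j * cnj (V k) = V' j * cnj (V' k)"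
      using X_tilde_product[OF x jk] X_tilde_product[OF x' jk] norms line_ends[OF jk] by metis
    then show "V j = V' j \<longleftrightarrow> V k = V' k"
      using X_tilde_line(3,4)[OF x jk] X_tilde_line(3,4)[OF x' jk] by auto
  qed
  then have "V = V'"
    using x x' by (intro extensionalityI[of V "{0..n}" V']) (auto simp: X_tilde_def)
  moreover from this have "I = I'"
    using x x' X_tilde_line(1)[OF x] X_tilde_line(1)[OF x']
    by (intro extensionalityI[of I E I']) (auto simp: X_tilde_def)
  ultimately show "x = x'"
    by (simp add: xs)
qed

lemma flow_in_X_cyc:
  assumes "x \<in> Xt"
  shows "flow_of_voltages n E x \<in> Xc"
proof -
  obtain S I V s where xs: "x = (S, I, V, s)" by (cases x)
  note x = assms[unfolded xs]
  define L where "L = restrict (\<lambda>l. (cmod (I l))\<^sup>2) E"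
  define v where "v = restrict (\<lambda>j. (cmod (V j))\<^sup>2) {0..n}"
  have v: "v j = (cmod (V j))\<^sup>2" if "j \<in> {0..n}" for j
    using that by (simp add: v_def)
  have L: "L l = (cmod (I l))\<^sup>2" if "l \<in> E" for l
    using that by (simp add: L_def)
  have "power_balance n E z S L s"
    using x power_balance_cong[of E L "\<lambda>l. (cmod (I l))\<^sup>2"] L by (simp add: X_tilde_def)
  moreover have "within_limits n vmin vmax smin smax v s"
    using x within_limits_cong[of n v "\<lambda>j. (cmod (V j))\<^sup>2"] v by (simp add: X_tilde_def)
  moreover have "voltage_drop E z S L v"
    unfolding voltage_drop_def
  proof clarify
    fix j k assume jk: "(j, k) \<in> E"
    show "v j - v k = 2 * Re (cnj (z (j, k)) * S (j, k)) - (cmod (z (j, k)))\<^sup>2 * L (j, k)"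
      using ohm_voltage_drop[OF z_nonzero[OF jk] X_tilde_line(1,2)[OF x jk]]
      by (simp only: v[OF line_ends(1)[OF jk]] v[OF line_ends(2)[OF jk]] L[OF jk])
  qed
  moreover have "v j * L (j, k) = (cmod (S (j, k)))\<^sup>2" if jk: "(j, k) \<in> E" for j k
    using X_tilde_line(2)[OF x jk] v[OF line_ends(1)[OF jk]] L[OF jk]
    by (simp add: norm_mult power_mult_distrib)
  moreover have "cycle_condition n E z S v"
    unfolding cycle_condition_iff[OF conn]
  \<comment> \<open>The voltage angles are the required potential; \<open>V 0 = 1\<close> has angle
    0.\<close>
  proof (intro exI[of _ "\<lambda>j. Arg (V j)"] conjI ballI, goal_cases)
    case 1
    then show ?case using x by (simp add: X_tilde_def)
  next
    case (2 l)
    obtain j k where l: "l = (j, k)" by fastforce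
    with 2 have jk: "(j, k) \<in> E" by simp
    have "branch_angle z S v (j, k) = Arg (V j * cnj (V k))"
      using X_tilde_product[OF x jk] v[OF line_ends(1)[OF jk]] by (simp add: branch_angle_def)
    then show ?case
      using rcong_Arg_mult_cnj X_tilde_line(3,4)[OF x jk] by (simp add: l)
  qed
  ultimately show ?thesis
    using x by (auto simp: xs flow_of_voltages_def X_cyc_def X_tilde_def L_def v_def)
qed

lemma X_cyc_in_image:
  assumes "y \<in> Xc"
  shows "y \<in> flow_of_voltages n E ` Xt"
proof -
  obtain S L v s where ys: "y = (S, L, v, s)" by (cases y)
  note y = assms[unfolded ys X_cyc_def, simplified]
  obtain \<theta> where \<theta>: "\<theta> 0 = 0"
      "\<And>j k. (j, k) \<in> E \<Longrightarrow> [\<theta> j - \<theta> k = branch_angle z S v (j, k)] (rmod (2 * pi))"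
    using y unfolding cycle_condition_iff[OF conn] by (auto split: prod.splits)
  have v_pos: "0 < v j" if "j \<in> {0..n}" for j
    using y within_limits_pos[OF _ that] by blast
  have v0: "v 0 = 1"
    using y slack by (force simp: within_limits_def)
  \<comment> \<open>Moduli come from \<open>v\<close> and angles from \<theta>;
    \<open>v 0 = 1\<close> and \<open>\<theta> 0 = 0\<close> give \<open>V 0 = 1\<close>. The
    currents are then dictated by Ohm's law.\<close>
  define V where "V = restrict (\<lambda>j. rcis (sqrt (v j)) (\<theta> j)) {0..n}"
  define I where "I = restrict (\<lambda>(j, k). admittance z (j, k) * (V j - V k)) E"
  have V: "V j = rcis (sqrt (v j)) (\<theta> j)" "(cmod (V j))\<^sup>2 = v j" if "j \<in> {0..n}" for j
    using that v_pos[OF that] by (simp_all add: V_def)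
  have product: "of_real (v j) - cnj (z (j, k)) * S (j, k) = V j * cnj (V k)"
    if jk: "(j, k) \<in> E" for j k
  proof -
    note ends = line_ends[OF jk]
    \<comment> \<open>The modulus of \<open>w\<close> follows from the two branch equations:
      \<open>v j * L (j, k)\<close> replaces the squared modulus of \<open>S (j, k)\<close>,
      \<open>v j\<close> factors out, and the voltage drop leaves \<open>v k\<close>. The cycle
      condition supplies its angle.\<close>
    define w where "w = of_real (v j) - cnj (z (j, k)) * S (j, k)"
    have "v j * L (j, k) = (cmod (S (j, k)))\<^sup>2"
      using y jk by auto
    moreover have "(cmod w)\<^sup>2 =
        (v j)\<^sup>2 - 2 * v j * Re (cnj (z (j, k)) * S (j, k)) + (cmod (z (j, k)))\<^sup>2 * (cmod (S (j, k)))\<^sup>2"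
      by (simp add: w_def cmod_diff_squared norm_mult power_mult_distrib)
    ultimately have "(cmod w)\<^sup>2 = v j * (v j - 2 * Re (cnj (z (j, k)) * S (j, k)) + (cmod (z (j, k)))\<^sup>2 * L (j, k))"
      by (simp flip: \<open>v j * L (j, k) = _\<close> add: power2_eq_square algebra_simps)
    also have "\<dots> = v j * v k"
      using y jk by (force simp: voltage_drop_def)
    finally have "cmod w = sqrt (v j * v k)"
      by (metis norm_ge_zero real_sqrt_unique)
    moreover have "cis (\<theta> j - \<theta> k) = cis (Arg w)"
      using \<theta>(2)[OF jk] by (simp add: cis_eq_iff branch_angle_def w_def)
    ultimately have "w = rcis (sqrt (v j * v k)) (\<theta> j - \<theta> k)"
      by (metis rcis_cmod_Arg rcis_def)
    also have "\<dots> = V j * cnj (V k)"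
      by (simp add: V(1)[OF ends(1)] V(1)[OF ends(2)] rcis_def cis_cnj real_sqrt_mult cis_divide [symmetric] divide_inverse)
    finally show ?thesis by (simp add: w_def)
  qed
  have S: "S (j, k) = V j * cnj (I (j, k))" if jk: "(j, k) \<in> E" for j k
  proof -
    have "V j * cnj (I (j, k)) = (V j * cnj (V j) - V j * cnj (V k)) / cnj (z (j, k))"
      using jk by (simp add: I_def admittance_def field_simps)
    \<comment> \<open>By \<open>product\<close>, the numerator is \<open>v j\<close> minus
      \<open>v j - cnj z * S\<close>, that is \<open>cnj z * S\<close>.\<close>
    also have "\<dots> = S (j, k)"
      using z_nonzero[OF jk] V(2)[OF line_ends(1)[OF jk]]
      by (simp add: product[OF jk, symmetric] complex_norm_square [symmetric])
    finally show ?thesis by simp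
  qed
  have L: "(cmod (I l))\<^sup>2 = L l" if "l \<in> E" for l
  proof -
    obtain j k where l: "l = (j, k)" by fastforce
    with that have jk: "(j, k) \<in> E" by simp
    \<comment> \<open>Both \<open>L\<close> and the squared current modulus give the squared modulus
      of \<open>S\<close> when multiplied by \<open>v j\<close>, and \<open>v j > 0\<close>
      cancels.\<close>
    have "v j * (cmod (I (j, k)))\<^sup>2 = (cmod (S (j, k)))\<^sup>2"
      using V(2)[OF line_ends(1)[OF jk]] by (simp add: S[OF jk] norm_mult power_mult_distrib)
    also have "\<dots> = v j * L (j, k)"
      using y jk by auto
    finally show ?thesis
      using v_pos[OF line_ends(1)[OF jk]] by (simp add: l)
  qed
  have "(S, I, V, s) \<in> Xt"
    using y S power_balance_cong[of E "\<lambda>l. (cmod (I l))\<^sup>2" L] L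
      within_limits_cong[of n "\<lambda>j. (cmod (V j))\<^sup>2" v] V(2) \<theta>(1) v0
    by (auto simp: X_tilde_def I_def V_def)
  moreover have "flow_of_voltages n E (S, I, V, s) = y"
  proof -
    have "restrict (\<lambda>l. (cmod (I l))\<^sup>2) E = L"
      using y L by (intro extensionalityI[of _ E]) auto
    moreover have "restrict (\<lambda>j. (cmod (V j))\<^sup>2) {0..n} = v"
      using y V(2) by (intro extensionalityI[of _ "{0..n}"]) auto
    ultimately show ?thesis
      by (simp add: ys flow_of_voltages_def)
  qed
  ultimately show ?thesis by force
qed

lemma X_tilde_eqpoll_X_cyc: "Xt \<approx> Xc"
  unfolding eqpoll_def bij_betw_def
  using inj_on_flow flow_in_X_cyc X_cyc_in_image by blast

end

section \<open>Inclusions between the feasible sets and the tree case\<close>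

theorem theorem9:
  fixes n :: nat
    and E :: "(nat \<times> nat) set"
    and z :: "nat \<times> nat \<Rightarrow> complex"
    and vmin vmax :: "nat \<Rightarrow> real"
    and smin smax :: "nat \<Rightarrow> ereal \<times> ereal"
  assumes "connected_network n E"
    and "\<And>l. l \<in> E \<Longrightarrow> z l \<noteq> 0"
    and "\<And>j. j \<in> {0..n} \<Longrightarrow> 0 < vmin j"
    and "\<And>j. j \<in> {0..n} \<Longrightarrow> vmin j \<le> vmax j"
    and "vmin 0 = 1" and "vmax 0 = 1"
    and "smin 0 = (-\<infinity>, -\<infinity>)" and "smax 0 = (\<infinity>, \<infinity>)"
  shows "X_tilde n E z vmin vmax smin smax \<approx> X_cyc n E z vmin vmax smin smax \<and>
         X_cyc n E z vmin vmax smin smax \<subseteq> X_nc n E z vmin vmax smin smax \<and>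
         X_nc n E z vmin vmax smin smax \<subseteq> X_plus n E z vmin vmax smin smax \<and>
         (tree_network n E \<longrightarrow>
           X_tilde n E z vmin vmax smin smax \<approx> X_cyc n E z vmin vmax smin smax \<and>
           X_cyc n E z vmin vmax smin smax = X_nc n E z vmin vmax smin smax \<and>
           X_nc n E z vmin vmax smin smax \<subseteq> X_plus n E z vmin vmax smin smax)"
proof -
  interpret network n E z vmin vmax smin smax
    using assms by unfold_locales auto
  have "X_cyc n E z vmin vmax smin smax \<subseteq> X_nc n E z vmin vmax smin smax"
    by (auto simp: X_cyc_def X_nc_def)
  moreover have "X_nc n E z vmin vmax smin smax \<subseteq> X_plus n E z vmin vmax smin smax"
    by (fastforce simp: X_nc_def X_plus_def)
  moreover have "X_cyc n E z vmin vmax smin smax = X_nc n E z vmin vmax smin smax"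
    if "tree_network n E"
    using cycle_condition_tree[OF that] by (auto simp: X_cyc_def X_nc_def)
  ultimately show ?thesis
    using X_tilde_eqpoll_X_cyc by blast
qed

end
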